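(* Suppose $k\ge1$ is constant. Then, for any positive constant $\alpha$, $$\mathbb{P}\big[\mathrm{comp}_{\min}(\mathbf{C}_{n,p})>k\big]\sim\begin{cases}0,&\text{if } q\gg n^{-1/2},\\ e^{-\alpha^2k},&\text{if } q\sim\alpha n^{-1/2},\\ 1,&\text{if } n^{-1/2}\gg q,\end{cases}$$ and $$\mathbb{P}\big[\mathrm{gap}_{\min}(\mathbf{C}_{n,p})>k\big]\sim\begin{cases}1,&\text{if } p\ll n^{-1/2},\\ e^{-\alpha^2k},&\text{if } p\sim\alpha n^{-1/2},\\ 0,&\text{if } n^{-1/2}\ll p.\end{cases}$$
   Context: An $n$-composition is a sequence of $n$ nonnegative integers. For $p=p(n)\in[0,1)$ and $q=1-p$, the geometric random composition $\mathbf{C}_{n,p}$ is the random $n$-composition whose terms are independent, with $\mathbb{P}[\mathbf{C}_{n,p}(i)=j]=qp^j$ for every $j\ge0$ and $i\in\{1,\dots,n\}$, where $\mathbf{C}_{n,p}(i)$ denotes the $i$th term. A component of a composition is a maximal run of (consecutive) nonzero terms; a gap is a maximal run of (consecutive) zero terms. For a composition $C$, $\mathrm{comp}_{\min}(C)$ is the length of the shortest component of $C$, and $\mathrm{gap}_{\min}(C)$ is the length of the shortest gap in $C$. For positive functions $f,g$ of $n$: $f\ll g$ (or $g\gg f$) means $\lim_{n\to\infty} f/g=0$, and $f\sim g$ means $\lim_{n\to\infty} f/g=1$; also, $f\sim 0$ means $\lim_{n\to\infty} f=0$. *)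

theory Defs
  imports "HOL-Probability.Probability" "HOL-Library.Landau_Symbols"
begin

text \<open>
  An \<open>n\<close>-composition is represented by a function on positions that is \<open>0\<close> outside \<open>{1..n}\<close>.
  Note that \<open>geometric_pmf q\<close> has mass \<open>(1 - q) ^ j * q\<close> at \<open>j\<close>, so its parameter is \<open>q = 1 - p\<close>.
\<close>

definition geom_composition :: "nat \<Rightarrow> real \<Rightarrow> (nat \<Rightarrow> nat) pmf" where
  "geom_composition n p = Pi_pmf {1..n} 0 (\<lambda>_. geometric_pmf (1 - p))"

text \<open>
  Runs are given by their sets of positions. Positions outside \<open>{1..n}\<close> never belong to a run, so
  the default value \<open>0\<close> does not prolong gaps.
\<close>

definition runs :: "nat \<Rightarrow> (nat \<Rightarrow> bool) \<Rightarrow> nat set set" where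
  "runs n P = {{a..b} | a b. 1 \<le> a \<and> a \<le> b \<and> b \<le> n \<and> (\<forall>i\<in>{a..b}. P i)}"

definition maximal_runs :: "nat \<Rightarrow> (nat \<Rightarrow> bool) \<Rightarrow> nat set set" where
  "maximal_runs n P = {I \<in> runs n P. \<forall>J \<in> runs n P. I \<subseteq> J \<longrightarrow> J = I}"

definition components :: "nat \<Rightarrow> (nat \<Rightarrow> nat) \<Rightarrow> nat set set" where
  "components n C = maximal_runs n (\<lambda>i. C i \<noteq> 0)"

definition gaps :: "nat \<Rightarrow> (nat \<Rightarrow> nat) \<Rightarrow> nat set set" where
  "gaps n C = maximal_runs n (\<lambda>i. C i = 0)"

text \<open>
  The minimum over an empty family of runs is taken to be \<open>0\<close>. With the value infinity instead, the
  limit \<open>0\<close> of the probability that the shortest component is longer than \<open>k\<close> would fail for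
  \<open>p = 0\<close> (no components), and likewise for gaps when \<open>p\<close> tends to \<open>1\<close> quickly.
\<close>

definition comp_min :: "nat \<Rightarrow> (nat \<Rightarrow> nat) \<Rightarrow> nat" where
  "comp_min n C = (if components n C = {} then 0 else Min (card ` components n C))"

definition gap_min :: "nat \<Rightarrow> (nat \<Rightarrow> nat) \<Rightarrow> nat" where
  "gap_min n C = (if gaps n C = {} then 0 else Min (card ` gaps n C))"

end

theory Submission
  imports Defs "HOL-Real_Asymp.Real_Asymp"
begin

text \<open>
  Components and gaps are exchanged by swapping the roles of nonzero and zero terms, so both halves
  are the same question about a word of \<open>n\<close> independent letters that are true with probability \<open>v\<close>
  and false with probability \<open>u = 1 - v\<close>: how likely is it that there is a run of true letters and
  all such runs are longer than \<open>k\<close>? For components \<open>u = q\<close>, for gaps \<open>u = p\<close>. A run of a given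
  length \<open>j \<ge> 1\<close> that is enclosed by two false letters starts at a given position with probability
  \<open>u\<^sup>2 v\<^sup>j\<close>, so about \<open>k n u\<^sup>2\<close> short runs are expected when \<open>u\<close> is small, and one expects
  the limit \<open>exp (- k L)\<close> if \<open>n u\<^sup>2\<close> tends to \<open>L\<close>.

  This is made precise by a recursion. Let \<open>survival n\<close> be the probability that no
  short run enclosed by two false letters has been completed within the first \<open>n\<close> letters, and
  \<open>renewal n\<close> the probability that in addition the letter \<open>n\<close> is false. Looking at the last letter
  yields
    \<open>survival (n + 1) = v * survival n + renewal (n + 1)\<close> and
    \<open>survival n - survival (n + 1) = u * (\<Sum>j = 1..k. v ^ j * renewal (n - j))\<close>
  (\<open>survival_Suc\<close>, \<open>survival_diff\<close>). As survival is antitone but loses at most the factor \<open>v\<close> in each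
  step, these two equations bound the one-step ratio \<open>survival (n + 1) / survival n\<close>, after the first \<open>k + 1\<close>
  steps, on both sides by \<open>1 - k u\<^sup>2 (1 + o(1))\<close> as \<open>u\<close> tends to \<open>0\<close>, and \<open>n\<close>-th powers of this give the exponential limit
  (\<open>survival_lower\<close>, \<open>survival_upper\<close>). The runs at the two ends of the word are enclosed on one side
  only; they change the probability by \<open>O(u)\<close> (\<open>Pr_runs_longer_ge\<close>).

  If \<open>n u\<^sup>2\<close> tends to infinity, \<open>u\<close> need not be small. The same recursion, applied to the
  pattern false-true-false in disjoint blocks of three letters, bounds the probability by
  \<open>(1 - u\<^sup>2 v) ^ (n div 3)\<close>, which suffices unless \<open>v\<close> is very small; in that case there are typically no
  two adjacent true letters, so no run is longer than \<open>1\<close> (\<open>Pr_runs_longer_tendsto_0\<close>).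
\<close>

section \<open>Maximal runs\<close>

text \<open>
  A run has to exist because the shortest length in an empty family of runs counts as \<open>0\<close>.
\<close>

definition runs_longer_than :: "nat \<Rightarrow> nat \<Rightarrow> (nat \<Rightarrow> bool) \<Rightarrow> bool" where
  "runs_longer_than k n P \<longleftrightarrow>
     maximal_runs n P \<noteq> {} \<and> (\<forall>I\<in>maximal_runs n P. k < card I)"

lemma finite_maximal_runs: "finite (maximal_runs n P)"
proof (rule finite_subset)
  show "maximal_runs n P \<subseteq> Pow {1..n}"
    by (auto simp: maximal_runs_def runs_def)
qed simp

lemma Min_run_gt_iff:
  "k < (if maximal_runs n P = {} then 0 else Min (card ` maximal_runs n P))
     \<longleftrightarrow> runs_longer_than k n P"
  using finite_maximal_runs[of n P] by (auto simp: runs_longer_than_def)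

lemma runsI:
  "1 \<le> a \<Longrightarrow> a \<le> b \<Longrightarrow> b \<le> n \<Longrightarrow> (\<And>i. a \<le> i \<Longrightarrow> i \<le> b \<Longrightarrow> P i) \<Longrightarrow> {a..b} \<in> runs n P"
  by (auto simp: runs_def)

lemma maximal_runI:
  assumes "1 \<le> a" "a \<le> b" "b \<le> n" "\<And>i. a \<le> i \<Longrightarrow> i \<le> b \<Longrightarrow> P i"
    and left: "a = 1 \<or> \<not> P (a - 1)" and right: "b = n \<or> \<not> P (Suc b)"
  shows "{a..b} \<in> maximal_runs n P"
  unfolding maximal_runs_def
proof (intro CollectI conjI ballI impI)
  show "{a..b} \<in> runs n P"
    using assms(1-4) by (auto simp: runs_def)
  fix J assume "J \<in> runs n P" and sub: "{a..b} \<subseteq> J"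
  then obtain c d where J: "J = {c..d}" "1 \<le> c" "d \<le> n" "\<And>i. i \<in> {c..d} \<Longrightarrow> P i"
    by (auto simp: runs_def)
  have ca: "c \<le> a" "b \<le> d" using sub J(1) assms(2) by auto
  have "c = a"
  proof (rule ccontr)
    assume "c \<noteq> a"
    then have "a \<noteq> 1" "a - 1 \<in> {c..d}" using ca J(2) assms(2) by auto
    then show False using J(4) left by blast
  qed
  moreover have "d = b"
  proof (rule ccontr)
    assume "d \<noteq> b"
    then have "b \<noteq> n" "Suc b \<in> {c..d}" using ca J(3) assms(2) by auto
    then show False using J(4) right by blast
  qed
  ultimately show "J = {a..b}" using J(1) by simp
qed

lemma maximal_runE:
  assumes "I \<in> maximal_runs n P"
  obtains a b where "I = {a..b}" "1 \<le> a" "a \<le> b" "b \<le> n" "\<And>i. a \<le> i \<Longrightarrow> i \<le> b \<Longrightarrow> P i"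
    "a = 1 \<or> \<not> P (a - 1)" "b = n \<or> \<not> P (Suc b)"
proof -
  from assms obtain a b where I: "I = {a..b}" "1 \<le> a" "a \<le> b" "b \<le> n" "\<And>i. i \<in> {a..b} \<Longrightarrow> P i"
    and max: "\<And>J. J \<in> runs n P \<Longrightarrow> I \<subseteq> J \<Longrightarrow> J = I"
    by (auto simp: maximal_runs_def runs_def)
  have "a = 1 \<or> \<not> P (a - 1)"
  proof (rule ccontr)
    assume *: "\<not> ?thesis"
    have "P i" if "a - 1 \<le> i" "i \<le> b" for i
      using * I(5)[of i] that by (cases "i = a - 1") auto
    then have "{a - 1..b} \<in> runs n P"
      using * I(2-4) by (intro runsI) auto
    from max[OF this] have "{a - 1..b} = {a..b}"
      using I(1) by auto
    then have "a - 1 \<in> {a..b}" using I(3) by auto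
    then show False using * I(2) by auto
  qed
  moreover have "b = n \<or> \<not> P (Suc b)"
  proof (rule ccontr)
    assume *: "\<not> ?thesis"
    have "P i" if "a \<le> i" "i \<le> Suc b" for i
      using * I(5)[of i] that by (cases "i = Suc b") auto
    then have "{a..Suc b} \<in> runs n P"
      using * I(2-4) by (intro runsI) auto
    from max[OF this] have "{a..Suc b} = {a..b}"
      using I(1) by auto
    then have "Suc b \<in> {a..b}" using I(3) by auto
    then show False by auto
  qed
  ultimately show ?thesis using I that by auto
qed

text \<open>
  Ignoring the runs that touch an end of the word makes the condition hereditary: whether an inner
  run is short is settled as soon as the false letter after it appears, whereas a run that reaches
  the current end may still grow.
\<close>

definition inner_runs_long :: "nat \<Rightarrow> nat \<Rightarrow> (nat \<Rightarrow> bool) \<Rightarrow> bool" where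
  "inner_runs_long k n P \<longleftrightarrow>
     (\<forall>a b. 1 \<le> a \<and> Suc a < b \<and> b \<le> n \<and> \<not> P a \<and> \<not> P b \<and> (\<forall>i\<in>{a<..<b}. P i)
        \<longrightarrow> k < b - Suc a)"

lemma runs_longer_imp_inner:
  assumes "runs_longer_than k n P"
  shows "inner_runs_long k n P"
  unfolding inner_runs_long_def
proof (intro allI impI)
  fix a b assume *: "1 \<le> a \<and> Suc a < b \<and> b \<le> n \<and> \<not> P a \<and> \<not> P b \<and> (\<forall>i\<in>{a<..<b}. P i)"
  then have "{Suc a..b - 1} \<in> maximal_runs n P"
    by (intro maximal_runI) auto
  then have "k < card {Suc a..b - 1}"
    using assms unfolding runs_longer_than_def by blast
  then show "k < b - Suc a" using * by simp
qed

text \<open>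
  Conversely, only the two runs at the ends can violate the condition; they are long if there is no
  false letter among the first and the last \<open>k + 1\<close> letters, and in this case a run also exists.
\<close>

lemma inner_imp_runs_longer:
  assumes inner: "inner_runs_long k n P" and n: "Suc k \<le> n"
    and left: "\<And>i. 1 \<le> i \<Longrightarrow> i \<le> Suc k \<Longrightarrow> P i"
    and right: "\<And>i. n - k \<le> i \<Longrightarrow> i \<le> n \<Longrightarrow> P i"
  shows "runs_longer_than k n P"
  unfolding runs_longer_than_def
proof (intro conjI ballI)
  \<comment> \<open>The run that starts at the first letter witnesses existence.\<close>
  define b where "b = (GREATEST b. b \<le> n \<and> (\<forall>i\<in>{1..b}. P i))"
  have b: "b \<le> n \<and> (\<forall>i\<in>{1..b}. P i)"
    unfolding b_def
    by (rule GreatestI_nat[where k = "Suc k" and b = n]) (use n left in auto)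
  have "Suc k \<le> b"
    unfolding b_def
    by (rule Greatest_le_nat[where b = n]) (use n left in auto)
  moreover have "b = n \<or> \<not> P (Suc b)"
  proof (rule ccontr)
    assume *: "\<not> ?thesis"
    then have "Suc b \<le> n \<and> (\<forall>i\<in>{1..Suc b}. P i)" using b by (auto simp: le_Suc_eq)
    then have "Suc b \<le> b" unfolding b_def by (rule Greatest_le_nat[where b = n]) auto
    then show False by simp
  qed
  ultimately have "{1..b} \<in> maximal_runs n P"
    using b by (intro maximal_runI) auto
  then show "maximal_runs n P \<noteq> {}" by blast
next
  fix I assume "I \<in> maximal_runs n P"
  then obtain a b where I: "I = {a..b}" "1 \<le> a" "a \<le> b" "b \<le> n" "\<And>i. a \<le> i \<Longrightarrow> i \<le> b \<Longrightarrow> P i"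
    "a = 1 \<or> \<not> P (a - 1)" "b = n \<or> \<not> P (Suc b)"
    by (rule maximal_runE) blast
  show "k < card I"
  proof (rule ccontr)
    assume "\<not> k < card I"
    then have short: "Suc b - a \<le> k" using I(1) by simp
    have "a \<noteq> 1"
    proof
      assume "a = 1"
      then have "b < Suc k" using short by simp
      then have "P (Suc b)" "b \<noteq> n" using left[of "Suc b"] n by auto
      then show False using I(7) by blast
    qed
    moreover have "b \<noteq> n"
    proof
      assume "b = n"
      then have "P (a - 1)" using short I(2,3) by (intro right) auto
      then show False using I(6) \<open>a \<noteq> 1\<close> by blast
    qed
    ultimately have "k < Suc b - Suc (a - 1)"
      using inner I unfolding inner_runs_long_def
      by (elim allE[of _ "a - 1"] allE[of _ "Suc b"]) auto
    then show False using short I(2) by simp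
  qed
qed

lemma runs_longer_imp_adjacent:
  assumes "runs_longer_than k n P" "k \<ge> 1"
  shows "\<exists>i\<in>{1..<n}. P i \<and> P (Suc i)"
proof -
  from assms(1) obtain I where I: "I \<in> maximal_runs n P" "k < card I"
    unfolding runs_longer_than_def by blast
  from I(1) obtain a b where "I = {a..b}" "1 \<le> a" "a \<le> b" "b \<le> n" "\<And>i. a \<le> i \<Longrightarrow> i \<le> b \<Longrightarrow> P i"
    by (rule maximal_runE) blast
  then show ?thesis using I(2) assms(2) by (intro bexI[of _ a]) auto
qed

lemma inner_runs_long_mono:
  "inner_runs_long k n P \<Longrightarrow> m \<le> n \<Longrightarrow> inner_runs_long k m P"
  unfolding inner_runs_long_def by force

lemma inner_runs_long_append_run:
  assumes "m \<le> n" "\<forall>i\<in>{m<..n}. P i"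
  shows "inner_runs_long k m P \<longleftrightarrow> inner_runs_long k n P"
proof
  assume m: "inner_runs_long k m P"
  have "b \<le> m" if "b \<le> n" "\<not> P b" for b
    using assms(2) that by force
  with m show "inner_runs_long k n P"
    unfolding inner_runs_long_def by blast
qed (use assms(1) in \<open>auto intro: inner_runs_long_mono\<close>)

text \<open>
  A new short run of length \<open>j\<close> can only be completed by a false letter at \<open>n + 1\<close>; it is preceded by
  a false letter at \<open>n - j\<close>. The letters between these cannot interact with the part up to \<open>n - j\<close>,
  which is why the events for different \<open>j\<close> have product probabilities.
\<close>

lemma first_short_run:
  "inner_runs_long k n P \<and> \<not> inner_runs_long k (Suc n) P \<longleftrightarrow>
   (\<exists>j\<in>{j \<in> {1..k}. j < n}. inner_runs_long k (n - j) P \<and> \<not> P (n - j) \<and>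
      (\<forall>i\<in>{n - j<..n}. P i) \<and> \<not> P (Suc n))" (is "?L \<longleftrightarrow> ?R")
proof
  assume L: ?L
  then obtain a b where ab: "1 \<le> a" "Suc a < b" "b \<le> Suc n" "\<not> P a" "\<not> P b"
      "\<forall>i\<in>{a<..<b}. P i" "\<not> k < b - Suc a"
    unfolding inner_runs_long_def by blast
  have b: "b = Suc n"
  proof (rule ccontr)
    assume "b \<noteq> Suc n"
    then have "b \<le> n" using ab(3) by simp
    with L ab show False unfolding inner_runs_long_def by blast
  qed
  have "n - (n - a) = a" using ab b by simp
  moreover have "inner_runs_long k a P" using L ab b by (auto intro: inner_runs_long_mono)
  ultimately show ?R
    using ab b by (intro bexI[of _ "n - a"]) auto
next
  assume ?R
  then obtain j where j: "j \<in> {1..k}" "j < n" "inner_runs_long k (n - j) P" "\<not> P (n - j)"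
      "\<forall>i\<in>{n - j<..n}. P i" "\<not> P (Suc n)"
    by blast
  have "inner_runs_long k n P"
    using j inner_runs_long_append_run[of "n - j" n P k] by simp
  moreover have "\<not> inner_runs_long k (Suc n) P"
  proof
    assume "inner_runs_long k (Suc n) P"
    then have "k < Suc n - Suc (n - j)"
      unfolding inner_runs_long_def
      by (elim allE[of _ "n - j"] allE[of _ "Suc n"]) (use j in auto)
    then show False using j by auto
  qed
  ultimately show ?L by blast
qed

section \<open>Random words\<close>

definition determined_by :: "nat \<Rightarrow> ((nat \<Rightarrow> bool) \<Rightarrow> bool) \<Rightarrow> bool" where
  "determined_by n E \<longleftrightarrow> (\<forall>P i y. n < i \<longrightarrow> E (P(i := y)) = E P)"

lemma determined_by_mono: "determined_by m E \<Longrightarrow> m \<le> n \<Longrightarrow> determined_by n E"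
  by (auto simp: determined_by_def)

lemma determined_by_conj:
  "determined_by n E \<Longrightarrow> determined_by n F \<Longrightarrow> determined_by n (\<lambda>P. E P \<and> F P)"
  by (auto simp: determined_by_def)

lemma determined_by_at: "i \<le> n \<Longrightarrow> determined_by n (\<lambda>P. P i)" "i \<le> n \<Longrightarrow> determined_by n (\<lambda>P. \<not> P i)"
  by (auto simp: determined_by_def)

lemma determined_by_Ball: "A \<subseteq> {..n} \<Longrightarrow> determined_by n (\<lambda>P. \<forall>i\<in>A. P i)"
  by (fastforce simp: determined_by_def)

lemma determined_by_inner_runs_long: "determined_by n (inner_runs_long k n)"
  unfolding determined_by_def
proof (intro allI impI)
  fix P :: "nat \<Rightarrow> bool" and i y assume i: "n < i"
  have eq: "(P(i := y)) j = P j" if "j \<le> n" for j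
    using i that by simp
  have "(1 \<le> a \<and> Suc a < b \<and> b \<le> n \<and> \<not> (P(i := y)) a \<and> \<not> (P(i := y)) b \<and> (\<forall>j\<in>{a<..<b}. (P(i := y)) j))
      \<longleftrightarrow> (1 \<le> a \<and> Suc a < b \<and> b \<le> n \<and> \<not> P a \<and> \<not> P b \<and> (\<forall>j\<in>{a<..<b}. P j))" for a b
    using eq[of a] eq[of b] i by (cases "b \<le> n") auto
  then show "inner_runs_long k n (P(i := y)) = inner_runs_long k n P"
    unfolding inner_runs_long_def by presburger
qed

text \<open>
  The letter \<open>dflt\<close> fills the positions outside \<open>{1..n}\<close>. It is a parameter since the default term \<open>0\<close>
  of a composition counts as false when components are considered and as true for gaps.
\<close>

locale bernoulli_word =
  fixes v :: real and dflt :: bool and k :: nat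
  assumes v: "0 \<le> v" "v \<le> 1"
begin

abbreviation (input) u :: real where "u \<equiv> 1 - v"

definition Pr :: "nat \<Rightarrow> ((nat \<Rightarrow> bool) \<Rightarrow> bool) \<Rightarrow> real" where
  "Pr n E = measure_pmf.prob (Pi_pmf {1..n} dflt (\<lambda>_. bernoulli_pmf v)) {P. E P}"

lemma Pr_Suc:
  assumes "determined_by n E"
  shows "Pr (Suc n) (\<lambda>P. E P \<and> P (Suc n)) = v * Pr n E"
    and "Pr (Suc n) (\<lambda>P. E P \<and> \<not> P (Suc n)) = u * Pr n E"
proof -
  let ?M = "Pi_pmf {1..n} dflt (\<lambda>_. bernoulli_pmf v)"
  have E: "E (P(Suc n := y)) = E P" for P y
    using assms by (auto simp: determined_by_def)
  have step: "Pr (Suc n) F = v * Pr n (\<lambda>P. F (P(Suc n := True))) + u * Pr n (\<lambda>P. F (P(Suc n := False)))" for F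
  proof -
    have "Pi_pmf {1..Suc n} dflt (\<lambda>_. bernoulli_pmf v) =
        bernoulli_pmf v \<bind> (\<lambda>y. map_pmf (\<lambda>P. P(Suc n := y)) ?M)"
      using Pi_pmf_insert'[of "{1..n}" "Suc n" dflt "\<lambda>_. bernoulli_pmf v"]
      by (simp add: atLeastAtMostSuc_conv map_pmf_def)
    then have "ennreal (Pr (Suc n) F) = (\<integral>\<^sup>+ y. ennreal (Pr n (\<lambda>P. F (P(Suc n := y)))) \<partial>bernoulli_pmf v)"
      by (simp add: Pr_def vimage_def measure_pmf.emeasure_eq_measure[symmetric])
    also have "\<dots> = ennreal (Pr n (\<lambda>P. F (P(Suc n := True))) * v + Pr n (\<lambda>P. F (P(Suc n := False))) * u)"
      using v by (simp add: Pr_def ennreal_mult)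
    finally have "Pr (Suc n) F = Pr n (\<lambda>P. F (P(Suc n := True))) * v + Pr n (\<lambda>P. F (P(Suc n := False))) * u"
      using v by (subst (asm) ennreal_inj) (auto simp: Pr_def)
    then show ?thesis by (simp add: mult.commute)
  qed
  show "Pr (Suc n) (\<lambda>P. E P \<and> P (Suc n)) = v * Pr n E"
    by (subst step) (simp add: E Pr_def)
  show "Pr (Suc n) (\<lambda>P. E P \<and> \<not> P (Suc n)) = u * Pr n E"
    by (subst step) (simp add: E Pr_def)
qed


lemma Pr_nonneg: "0 \<le> Pr n E" and Pr_le_1: "Pr n E \<le> 1"
  by (simp_all add: Pr_def)

lemma Pr_cong: "(\<And>P. E P = F P) \<Longrightarrow> Pr n E = Pr n F"
  by (simp add: Pr_def)

lemma Pr_mono: "(\<And>P. E P \<Longrightarrow> F P) \<Longrightarrow> Pr n E \<le> Pr n F"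
  unfolding Pr_def by (rule measure_pmf.finite_measure_mono) auto

lemma Pr_disj_le: "Pr n (\<lambda>P. E P \<or> F P) \<le> Pr n E + Pr n F"
  by (simp add: Pr_def Collect_disj_eq measure_Un_le)

lemma Pr_Bex_le:
  assumes "finite A"
  shows "Pr n (\<lambda>P. \<exists>i\<in>A. E i P) \<le> (\<Sum>i\<in>A. Pr n (E i))"
proof -
  have "{P. \<exists>i\<in>A. E i P} = (\<Union>i\<in>A. {P. E i P})" by auto
  then show ?thesis
    using measure_pmf.finite_measure_subadditive_finite[OF assms, of "\<lambda>i. {P. E i P}"]
    by (simp add: Pr_def)
qed

lemma Pr_split: "Pr n E = Pr n (\<lambda>P. E P \<and> F P) + Pr n (\<lambda>P. E P \<and> \<not> F P)"
proof -
  have "{P. E P} = {P. E P \<and> F P} \<union> {P. E P \<and> \<not> F P}" by auto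
  then show ?thesis
    unfolding Pr_def by (subst (1) \<open>{P. E P} = _\<close>, subst measure_pmf.finite_measure_Union) auto
qed

lemma Pr_extend:
  assumes "determined_by m E" "m \<le> n"
  shows "Pr n E = Pr m E"
  using assms(2)
proof (induction n rule: dec_induct)
  case (step n)
  have "determined_by n E" using assms(1) step(1) by (rule determined_by_mono)
  then have "Pr (Suc n) E = v * Pr n E + u * Pr n E"
    by (subst Pr_split[where F = "\<lambda>P. P (Suc n)"]) (simp add: Pr_Suc)
  then show ?case using step by (simp add: algebra_simps)
qed simp

lemma Pr_true: "Pr n (\<lambda>_. True) = 1"
  by (simp add: Pr_def)

lemma Pr_not_at:
  assumes "1 \<le> i" "i \<le> n"
  shows "Pr n (\<lambda>P. \<not> P i) = u"
proof -
  have "Pr n (\<lambda>P. \<not> P i) = Pr i (\<lambda>P. \<not> P i)"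
    using assms by (intro Pr_extend determined_by_at) auto
  also have "\<dots> = u"
    using Pr_Suc(2)[of "i - 1" "\<lambda>_. True"] assms(1) by (simp add: Pr_true determined_by_def)
  finally show ?thesis .
qed

text \<open>Appending a run of \<open>j\<close> true letters costs the factor \<open>v\<close> per letter, by independence.\<close>

lemma Pr_then_run:
  assumes "determined_by m E"
  shows "Pr (m + j) (\<lambda>P. E P \<and> (\<forall>i\<in>{m<..m + j}. P i)) = v ^ j * Pr m E"
proof (induction j)
  case (Suc j)
  have "Pr (m + Suc j) (\<lambda>P. E P \<and> (\<forall>i\<in>{m<..m + Suc j}. P i)) =
      Pr (Suc (m + j)) (\<lambda>P. (E P \<and> (\<forall>i\<in>{m<..m + j}. P i)) \<and> P (Suc (m + j)))"
    unfolding add_Suc_right by (rule Pr_cong) (auto simp: le_Suc_eq)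
  also have "\<dots> = v * Pr (m + j) (\<lambda>P. E P \<and> (\<forall>i\<in>{m<..m + j}. P i))"
    using assms
    by (intro Pr_Suc(1) determined_by_conj determined_by_Ball) (auto intro: determined_by_mono)
  finally show ?case using Suc by simp
qed (simp add: Pr_def)

lemma Pr_two_at:
  assumes "1 \<le> i" "i < n"
  shows "Pr n (\<lambda>P. P i \<and> P (Suc i)) = v\<^sup>2"
proof -
  have "Pr n (\<lambda>P. P i \<and> P (Suc i)) = Pr (Suc i) (\<lambda>P. P i \<and> P (Suc i))"
    using assms by (intro Pr_extend determined_by_conj determined_by_at) auto
  also have "\<dots> = Pr (i - 1 + 2) (\<lambda>P. True \<and> (\<forall>j\<in>{i - 1<..i - 1 + 2}. P j))"
  proof -
    have "{i - 1<..i - 1 + 2} = {i, Suc i}" "i - 1 + 2 = Suc i" using assms(1) by auto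
    then show ?thesis by simp
  qed
  also have "\<dots> = v\<^sup>2"
    by (subst Pr_then_run) (auto simp: Pr_true determined_by_def)
  finally show ?thesis .
qed

section \<open>The survival recursion\<close>

definition survival :: "nat \<Rightarrow> real" where
  "survival n = Pr n (inner_runs_long k n)"

text \<open>
  The value \<open>0\<close> at \<open>0\<close> encodes that no false letter precedes the word: a run that starts at the first
  letter is not an inner run. It also makes the terms with \<open>j \<ge> n\<close> in the recursion for
  \<open>survival\<close> vanish, as \<open>n - j\<close> is then \<open>0\<close>.
\<close>

definition renewal :: "nat \<Rightarrow> real" where
  "renewal n = (if n = 0 then 0 else Pr n (\<lambda>P. inner_runs_long k n P \<and> \<not> P n))"

lemma survival_Suc: "survival (Suc n) = v * survival n + renewal (Suc n)"
proof -
  have "Pr (Suc n) (\<lambda>P. inner_runs_long k (Suc n) P \<and> P (Suc n)) =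
      Pr (Suc n) (\<lambda>P. inner_runs_long k n P \<and> P (Suc n))"
    proof (rule Pr_cong)
    have "{n<..Suc n} = {Suc n}" by auto
    then show "inner_runs_long k (Suc n) P \<and> P (Suc n) \<longleftrightarrow> inner_runs_long k n P \<and> P (Suc n)" for P
      using inner_runs_long_append_run[of n "Suc n" P k] by auto
  qed
  also have "\<dots> = v * survival n"
    unfolding survival_def by (intro Pr_Suc determined_by_inner_runs_long)
  finally show ?thesis
    unfolding survival_def renewal_def by (subst Pr_split[where F = "\<lambda>P. P (Suc n)"]) simp
qed

text \<open>
  The loss of survival in one step is split by the length \<open>j\<close> of the short run that the last letter
  completes; the position of the preceding false letter makes these events disjoint.
\<close>

lemma survival_diff: "survival n - survival (Suc n) = u * (\<Sum>j=1..k. v ^ j * renewal (n - j))"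
proof -
  define B where "B j P \<longleftrightarrow> inner_runs_long k (n - j) P \<and> \<not> P (n - j) \<and>
    (\<forall>i\<in>{n - j<..n}. P i) \<and> \<not> P (Suc n)" for j P
  let ?J = "{j \<in> {1..k}. j < n}"
  have PrB: "Pr (Suc n) (B j) = u * (v ^ j * renewal (n - j))" if "j \<in> ?J" for j
  proof -
    have "Pr (Suc n) (B j) = Pr (Suc n) (\<lambda>P. ((inner_runs_long k (n - j) P \<and> \<not> P (n - j)) \<and>
        (\<forall>i\<in>{n - j<..n}. P i)) \<and> \<not> P (Suc n))"
      by (rule Pr_cong) (simp add: B_def)
    also have "\<dots> = u * Pr n (\<lambda>P. (inner_runs_long k (n - j) P \<and> \<not> P (n - j)) \<and>
        (\<forall>i\<in>{n - j<..n}. P i))"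
      by (intro Pr_Suc determined_by_conj determined_by_Ball determined_by_at
          determined_by_mono[OF determined_by_inner_runs_long]) auto
    also have "Pr n (\<lambda>P. (inner_runs_long k (n - j) P \<and> \<not> P (n - j)) \<and>
        (\<forall>i\<in>{n - j<..n}. P i)) = v ^ j * Pr (n - j) (\<lambda>P. inner_runs_long k (n - j) P \<and> \<not> P (n - j))"
      using Pr_then_run[of "n - j" "\<lambda>P. inner_runs_long k (n - j) P \<and> \<not> P (n - j)" j] that
      by (simp add: determined_by_conj determined_by_inner_runs_long determined_by_at)
    finally show ?thesis using that by (simp add: renewal_def)
  qed
  have "survival n = Pr (Suc n) (inner_runs_long k n)"
    unfolding survival_def by (rule Pr_extend[OF determined_by_inner_runs_long, symmetric]) simp
  also have "\<dots> = Pr (Suc n) (\<lambda>P. inner_runs_long k n P \<and> inner_runs_long k (Suc n) P)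
      + Pr (Suc n) (\<lambda>P. inner_runs_long k n P \<and> \<not> inner_runs_long k (Suc n) P)"
    by (rule Pr_split)
  also have "Pr (Suc n) (\<lambda>P. inner_runs_long k n P \<and> inner_runs_long k (Suc n) P) = survival (Suc n)"
    unfolding survival_def by (rule Pr_cong) (auto intro: inner_runs_long_mono)
  also have "Pr (Suc n) (\<lambda>P. inner_runs_long k n P \<and> \<not> inner_runs_long k (Suc n) P) =
      Pr (Suc n) (\<lambda>P. \<exists>j\<in>?J. B j P)"
    unfolding B_def by (rule Pr_cong[OF first_short_run])
  also have "\<dots> = (\<Sum>j\<in>?J. Pr (Suc n) (B j))"
  proof -
    have "{P. \<exists>j\<in>?J. B j P} = (\<Union>j\<in>?J. {P. B j P})" by auto
    moreover have "disjoint_family_on (\<lambda>j. {P. B j P}) ?J"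
    proof (unfold disjoint_family_on_def, intro ballI impI)
      have *: "\<not> (B i P \<and> B j P)" if "i < j" "j \<in> ?J" for i j P
        using that by (auto simp: B_def)
      show "{P. B i P} \<inter> {P. B j P} = {}" if "i \<in> ?J" "j \<in> ?J" "i \<noteq> j" for i j
        using that *[of i j] *[of j i] by (cases i j rule: linorder_cases) blast+
    qed
    ultimately show ?thesis
      unfolding Pr_def by (simp add: measure_pmf.finite_measure_finite_Union)
  qed
  also have "\<dots> = (\<Sum>j\<in>?J. u * (v ^ j * renewal (n - j)))"
    by (rule sum.cong) (simp_all add: PrB)
  also have "\<dots> = (\<Sum>j=1..k. u * (v ^ j * renewal (n - j)))"
    by (rule sum.mono_neutral_left) (auto simp: renewal_def)
  finally show ?thesis by (simp add: sum_distrib_left)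
qed

lemma renewal_nonneg: "0 \<le> renewal n"
  by (simp add: renewal_def Pr_nonneg)

lemma survival_nonneg: "0 \<le> survival n" and survival_le_1: "survival n \<le> 1"
  by (simp_all add: survival_def Pr_nonneg Pr_le_1)

lemma survival_antimono: "m \<le> n \<Longrightarrow> survival n \<le> survival m"
proof (rule lift_Suc_antimono_le)
  fix n
  have "0 \<le> u * (\<Sum>j=1..k. v ^ j * renewal (n - j))"
    using v by (intro mult_nonneg_nonneg sum_nonneg) (auto simp: renewal_nonneg)
  then show "survival (Suc n) \<le> survival n" using survival_diff[of n] by linarith
qed

lemma survival_ge: "v ^ j * survival m \<le> survival (m + j)"
proof (induction j)
  case (Suc j)
  have "v * (v ^ j * survival m) \<le> v * survival (m + j)"
    using Suc v by (intro mult_left_mono) auto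
  also have "\<dots> \<le> survival (m + Suc j)"
    using survival_Suc[of "m + j"] renewal_nonneg[of "Suc (m + j)"] by simp
  finally show ?case by (simp add: mult.assoc)
qed simp

lemma renewal_le: "renewal (Suc n) \<le> u * survival n"
  using survival_Suc[of n] survival_antimono[of n "Suc n"] by (simp add: algebra_simps)

text \<open>
  Every \<open>renewal (n - j)\<close> is at most \<open>u * survival (n - j - 1)\<close>, and going back \<open>j + 1\<close> steps increases
  survival by at most the factor \<open>1 / v ^ (j + 1)\<close>. So each of the \<open>k\<close> terms is at most
  \<open>u / v * survival n\<close>.
\<close>

lemma survival_diff_le:
  assumes "0 < v"
  shows "survival n - survival (Suc n) \<le> k * u\<^sup>2 / v * survival n"
proof -
  have "v ^ j * renewal (n - j) \<le> u / v * survival n" if "j \<in> {1..k}" for j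
  proof (cases "j < n")
    case True
    have "v ^ j * renewal (n - j) \<le> v ^ j * (u * survival (n - Suc j))"
      using renewal_le[of "n - Suc j"] True v by (intro mult_left_mono) (auto simp: Suc_diff_Suc)
    also have "\<dots> = u / v * (v ^ Suc j * survival (n - Suc j))"
      using assms by simp
    also have "\<dots> \<le> u / v * survival n"
      using survival_ge[of "Suc j" "n - Suc j"] True v by (intro mult_left_mono) auto
    finally show ?thesis .
  qed (use v in \<open>simp add: renewal_def survival_nonneg\<close>)
  then have "(\<Sum>j=1..k. v ^ j * renewal (n - j)) \<le> card {1..k} * (u / v * survival n)"
    by (rule sum_bounded_above)
  then have "(\<Sum>j=1..k. v ^ j * renewal (n - j)) \<le> k * (u / v * survival n)"
    by simp
  then have "u * (\<Sum>j=1..k. v ^ j * renewal (n - j)) \<le> u * (k * (u / v * survival n))"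
    using v by (intro mult_left_mono) auto
  then show ?thesis
    unfolding survival_diff by (simp add: power2_eq_square mult_ac)
qed

lemma survival_lower:
  assumes "0 < v" "k * u\<^sup>2 / v \<le> 1"
  shows "(1 - k * u\<^sup>2 / v) ^ n \<le> survival n"
proof (induction n)
  case 0
  have "Pr 0 (inner_runs_long k 0) = Pr 0 (\<lambda>_. True)"
    by (rule Pr_cong) (auto simp: inner_runs_long_def)
  then show ?case by (simp add: survival_def Pr_true)
next
  case (Suc n)
  have "(1 - k * u\<^sup>2 / v) ^ Suc n \<le> (1 - k * u\<^sup>2 / v) * survival n"
    using Suc assms(2) by (simp add: mult_left_mono)
  also have "\<dots> \<le> survival (Suc n)"
    using survival_diff_le[OF assms(1), of n] by (simp add: algebra_simps)
  finally show ?case .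
qed

text \<open>
  Since survival drops only by a fraction of order \<open>u\<^sup>2\<close> in one step, whereas a letter is false with
  probability \<open>u\<close>, renewal is almost \<open>u\<close> times survival: writing it as the difference
  \<open>survival (m + 1) - v * survival m\<close> and inserting the upper bound for the drop loses only the factor
  \<open>1 - k u / v\<close>. The condition on \<open>n\<close> ensures that all \<open>k\<close> run lengths fit behind a false letter.
\<close>

lemma survival_diff_ge:
  assumes "0 < v" "k * u / v \<le> 1" "Suc k \<le> n"
  shows "k * u\<^sup>2 * v ^ k * (1 - k * u / v) * survival n \<le> survival n - survival (Suc n)"
proof -
  let ?e = "1 - k * u / v"
  have "u * v ^ k * ?e * survival n \<le> v ^ j * renewal (n - j)" if "j \<in> {1..k}" for j
  proof -
    define m where "m = n - Suc j"
    have m: "n - j = Suc m" "m \<le> n" using that assms(3) by (auto simp: m_def)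
    have "u * ?e * survival n \<le> u * ?e * survival m"
      using assms v m by (intro mult_left_mono survival_antimono mult_nonneg_nonneg) auto
    also have "\<dots> \<le> renewal (Suc m)"
      using survival_Suc[of m] survival_diff_le[OF assms(1), of m] by (simp add: algebra_simps power2_eq_square)
    finally have "v ^ j * (u * ?e * survival n) \<le> v ^ j * renewal (n - j)"
      using v m by (intro mult_left_mono) auto
    moreover have "v ^ k * (u * ?e * survival n) \<le> v ^ j * (u * ?e * survival n)"
      using that v assms by (intro mult_right_mono power_decreasing mult_nonneg_nonneg) (auto simp: survival_nonneg)
    ultimately show ?thesis by (simp add: mult_ac)
  qed
  then have "card {1..k} * (u * v ^ k * ?e * survival n) \<le> (\<Sum>j=1..k. v ^ j * renewal (n - j))"
    by (rule sum_bounded_below)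
  then have "k * (u * v ^ k * ?e * survival n) \<le> (\<Sum>j=1..k. v ^ j * renewal (n - j))"
    by simp
  then have "u * (k * (u * v ^ k * ?e * survival n)) \<le> u * (\<Sum>j=1..k. v ^ j * renewal (n - j))"
    using v by (intro mult_left_mono) auto
  then show ?thesis
    unfolding survival_diff by (simp add: power2_eq_square mult_ac)
qed

lemma survival_upper:
  assumes "0 < v" "k * u / v \<le> 1" and le: "k * u\<^sup>2 * v ^ k * (1 - k * u / v) \<le> 1"
  shows "survival (Suc k + n) \<le> (1 - k * u\<^sup>2 * v ^ k * (1 - k * u / v)) ^ n"
proof (induction n)
  case 0
  show ?case by (simp add: survival_le_1)
next
  case (Suc n)
  let ?x = "k * u\<^sup>2 * v ^ k * (1 - k * u / v)"
  have "survival (Suc k + Suc n) \<le> (1 - ?x) * survival (Suc k + n)"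
    using survival_diff_ge[OF assms(1,2), of "Suc k + n"] by (simp add: algebra_simps)
  also have "\<dots> \<le> (1 - ?x) * (1 - ?x) ^ n"
    using Suc le by (intro mult_left_mono) auto
  finally show ?case by simp
qed

text \<open>
  Among three further letters the pattern false-true-false occurs with probability \<open>u\<^sup>2 v\<close>. Unlike
  the bounds above, this one is meaningful for every \<open>u\<close>. In terms of the recursion it is the term for
  \<open>j = 1\<close>.
\<close>

lemma survival_three_steps:
  assumes "1 \<le> k"
  shows "survival (n + 3) \<le> (1 - u\<^sup>2 * v) * survival n"
proof -
  have "v ^ 1 * renewal (n + 2 - 1) \<le> (\<Sum>j=1..k. v ^ j * renewal (n + 2 - j))"
    using assms v by (intro member_le_sum) (auto simp: renewal_nonneg)
  then have "u * (v * renewal (Suc n)) \<le> u * (\<Sum>j=1..k. v ^ j * renewal (n + 2 - j))"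
    using v by (intro mult_left_mono) auto
  also have "\<dots> = survival (n + 2) - survival (n + 3)"
    using survival_diff[of "n + 2"] by (simp add: numeral_eq_Suc)
  also have "survival (n + 2) \<le> survival (Suc n)"
    by (rule survival_antimono) simp
  finally have "survival (n + 3) \<le> (1 - u * v) * survival (Suc n) + u * v * v * survival n"
    using survival_Suc[of n] by (simp add: algebra_simps)
  also have "\<dots> \<le> (1 - u * v) * survival n + u * v * v * survival n"
    using v mult_le_one[of u v] by (intro add_right_mono mult_left_mono survival_antimono) auto
  finally show ?thesis by (simp add: algebra_simps power2_eq_square)
qed

lemma survival_block_bound:
  assumes "1 \<le> k"
  shows "survival n \<le> (1 - u\<^sup>2 * v) ^ (n div 3)"
proof -
  have 1: "0 \<le> 1 - u\<^sup>2 * v"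
    using v mult_le_one[of "u\<^sup>2" v] power_le_one[of u 2] by auto
  have "survival (3 * m) \<le> (1 - u\<^sup>2 * v) ^ m" for m
  proof (induction m)
    case 0
    show ?case by (simp add: survival_le_1)
  next
    case (Suc m)
    have "survival (3 * Suc m) \<le> (1 - u\<^sup>2 * v) * survival (3 * m)"
      using survival_three_steps[OF assms, of "3 * m"] by (simp add: add.commute)
    also have "\<dots> \<le> (1 - u\<^sup>2 * v) ^ Suc m"
      using Suc 1 by (simp add: mult_left_mono)
    finally show ?case .
  qed
  from order_trans[OF survival_antimono this] show ?thesis by simp
qed

section \<open>From inner runs to all runs\<close>

lemma Pr_runs_longer_le: "Pr n (runs_longer_than k n) \<le> survival n"
  unfolding survival_def by (intro Pr_mono runs_longer_imp_inner)

text \<open>The error is a union bound for a false letter among the first or the last \<open>k + 1\<close> letters.\<close>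

lemma Pr_runs_longer_ge:
  assumes "Suc k \<le> n"
  shows "survival n - 2 * Suc k * u \<le> Pr n (runs_longer_than k n)"
proof -
  let ?A = "{1..Suc k} \<union> {n - k..n}"
  have card: "real (card ?A) \<le> real (2 * Suc k)"
    using card_Un_le[of "{1..Suc k}" "{n - k..n}"] assms by (simp only: of_nat_le_iff) simp
  have "survival n \<le> Pr n (\<lambda>P. runs_longer_than k n P \<or> (\<exists>i\<in>?A. \<not> P i))"
    unfolding survival_def
  proof (rule Pr_mono)
    fix P assume "inner_runs_long k n P"
    then show "runs_longer_than k n P \<or> (\<exists>i\<in>?A. \<not> P i)"
      using assms by (cases "\<exists>i\<in>?A. \<not> P i") (auto intro!: inner_imp_runs_longer)
  qed
  also have "\<dots> \<le> Pr n (runs_longer_than k n) + Pr n (\<lambda>P. \<exists>i\<in>?A. \<not> P i)"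
    by (rule Pr_disj_le)
  also have "Pr n (\<lambda>P. \<exists>i\<in>?A. \<not> P i) \<le> (\<Sum>i\<in>?A. Pr n (\<lambda>P. \<not> P i))"
    by (rule Pr_Bex_le) simp
  also have "\<dots> = (\<Sum>i\<in>?A. u)"
    using assms by (intro sum.cong Pr_not_at) auto
  also have "\<dots> = card ?A * u"
    by simp
  also have "\<dots> \<le> 2 * Suc k * u"
    using card v by (intro mult_right_mono) auto
  finally show ?thesis by simp
qed

text \<open>A first-moment bound for words with few true letters, which survival does not control.\<close>

lemma Pr_runs_longer_le_adjacent:
  assumes "1 \<le> k"
  shows "Pr n (runs_longer_than k n) \<le> n * v\<^sup>2"
proof -
  have "Pr n (runs_longer_than k n) \<le> Pr n (\<lambda>P. \<exists>i\<in>{1..<n}. P i \<and> P (Suc i))"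
    using assms by (intro Pr_mono runs_longer_imp_adjacent)
  also have "\<dots> \<le> (\<Sum>i\<in>{1..<n}. Pr n (\<lambda>P. P i \<and> P (Suc i)))"
    by (rule Pr_Bex_le) simp
  also have "\<dots> = (n - 1) * v\<^sup>2"
    by (simp add: Pr_two_at)
  also have "\<dots> \<le> n * v\<^sup>2"
    by (intro mult_right_mono) auto
  finally show ?thesis .
qed

end

section \<open>Limits\<close>

lemma one_minus_power_ge_exp:
  fixes x :: real
  assumes "x < 1"
  shows "exp (- (real n * x / (1 - x))) \<le> (1 - x) ^ n"
proof -
  have "1 / (1 - x) \<le> exp (x / (1 - x))"
    using exp_ge_add_one_self[of "x / (1 - x)"] assms by (simp add: field_simps)
  then have "exp (- (x / (1 - x))) \<le> 1 - x"
    using assms by (simp add: exp_minus field_simps)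
  then have "exp (- (x / (1 - x))) ^ n \<le> (1 - x) ^ n"
    by (rule power_mono) simp
  then show ?thesis by (simp add: exp_of_nat_mult[symmetric])
qed

lemma one_minus_power_le_exp:
  fixes x :: real
  assumes "x \<le> 1"
  shows "(1 - x) ^ n \<le> exp (- (real n * x))"
proof -
  have "(1 - x) ^ n \<le> exp (- x) ^ n"
    using exp_ge_add_one_self[of "- x"] assms by (intro power_mono) auto
  then show ?thesis by (simp add: exp_of_nat_mult[symmetric])
qed

text \<open>
  The hypothesis forces \<open>u \<rightarrow> 0\<close>, so the upper bound \<open>x\<close> and the lower bound \<open>y\<close> for the
  relative loss of survival in one step satisfy \<open>n x \<rightarrow> k L\<close> and \<open>n y \<rightarrow> k L\<close>, and the error
  \<open>O(u)\<close> from the ends of the word vanishes. The case \<open>L = 0\<close> yields the limit \<open>1\<close>.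
\<close>

lemma Pr_runs_longer_tendsto_exp:
  fixes v :: "nat \<Rightarrow> real"
  assumes v: "\<And>n. 0 \<le> v n \<and> v n \<le> 1"
    and lim: "(\<lambda>n. real n * (1 - v n)\<^sup>2) \<longlonglongrightarrow> L"
  shows "(\<lambda>n. bernoulli_word.Pr (v n) dflt n (runs_longer_than k n)) \<longlonglongrightarrow> exp (- (real k * L))"
proof -
  define u where "u n = 1 - v n" for n
  define x where "x n = real k * (u n)\<^sup>2 / v n" for n
  define y where "y n = real k * (u n)\<^sup>2 * v n ^ k * (1 - real k * u n / v n)" for n
  define c where "c n = bernoulli_word.survival (v n) dflt k n" for n
  have word: "bernoulli_word (v n)" for n
    using v by unfold_locales auto
  have nu: "(\<lambda>n. real n * (u n)\<^sup>2) \<longlonglongrightarrow> L"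
    using lim by (simp add: u_def)
  have "(\<lambda>n. (real n * (u n)\<^sup>2) * (1 / real n)) \<longlonglongrightarrow> L * 0"
    by (intro tendsto_mult nu lim_1_over_n)
  then have "(\<lambda>n. (u n)\<^sup>2) \<longlonglongrightarrow> L * 0"
  proof (rule Lim_transform_eventually)
    show "eventually (\<lambda>n. (real n * (u n)\<^sup>2) * (1 / real n) = (u n)\<^sup>2) sequentially"
      using eventually_gt_at_top[of 0] by eventually_elim simp
  qed
  then have u: "u \<longlonglongrightarrow> 0"
    by simp
  have "(\<lambda>n. 1 - u n) \<longlonglongrightarrow> 1 - 0"
    by (intro tendsto_intros u)
  then have v1: "v \<longlonglongrightarrow> 1"
    by (simp add: u_def)
  have x: "x \<longlonglongrightarrow> 0" and y: "y \<longlonglongrightarrow> 0"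
    unfolding x_def y_def by (rule tendsto_eq_intros u v1 refl | simp)+
  have nx: "(\<lambda>n. real n * x n) \<longlonglongrightarrow> real k * L"
  proof -
    have "(\<lambda>n. real k * (real n * (u n)\<^sup>2) / v n) \<longlonglongrightarrow> real k * L / 1"
      by (intro tendsto_intros nu v1) simp
    then show ?thesis by (simp add: x_def mult_ac)
  qed
  have ny: "(\<lambda>n. real n * y n) \<longlonglongrightarrow> real k * L"
  proof -
    have "(\<lambda>n. real k * (real n * (u n)\<^sup>2) * v n ^ k * (1 - real k * u n / v n))
        \<longlonglongrightarrow> real k * L * 1 ^ k * (1 - real k * 0 / 1)"
      by (intro tendsto_intros nu u v1) simp
    then show ?thesis by (simp add: y_def mult_ac)
  qed
  have evs: "eventually (\<lambda>n. 0 < v n) sequentially" "eventually (\<lambda>n. x n < 1) sequentially"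
      "eventually (\<lambda>n. y n < 1) sequentially"
    using order_tendstoD(1)[OF v1, of 0] order_tendstoD(2)[OF x, of 1] order_tendstoD(2)[OF y, of 1]
    by simp_all
  have "(\<lambda>n. real k * u n / v n) \<longlonglongrightarrow> real k * 0 / 1"
    by (intro tendsto_intros u v1) simp
  then have evw: "eventually (\<lambda>n. real k * u n / v n < 1) sequentially"
    by (intro order_tendstoD) auto
  have c: "c \<longlonglongrightarrow> exp (- (real k * L))"
  proof (rule tendsto_sandwich)
    show "eventually (\<lambda>n. exp (- (real n * x n / (1 - x n))) \<le> c n) sequentially"
      using evs
    proof eventually_elim
      case (elim n)
      have "(1 - x n) ^ n \<le> c n"
        using bernoulli_word.survival_lower[OF word, of n k n dflt] elim by (simp add: c_def x_def u_def)
      then show ?case using one_minus_power_ge_exp[of "x n" n] elim by linarith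
    qed
    show "eventually (\<lambda>n. c n \<le> exp (- (real n * y n - real (Suc k) * y n))) sequentially"
      using evs evw eventually_ge_at_top[of "Suc k"]
    proof eventually_elim
      case (elim n)
      have "c n \<le> (1 - y n) ^ (n - Suc k)"
        using bernoulli_word.survival_upper[OF word, of n k dflt "n - Suc k"] elim
        by (simp add: c_def y_def u_def)
      also have "\<dots> \<le> exp (- (real (n - Suc k) * y n))"
        using elim by (intro one_minus_power_le_exp) auto
      finally show ?case using elim by (simp add: algebra_simps)
    qed
    have "(\<lambda>n. exp (- (real n * x n / (1 - x n)))) \<longlonglongrightarrow> exp (- (real k * L / (1 - 0)))"
      by (intro tendsto_intros nx x) simp
    then show "(\<lambda>n. exp (- (real n * x n / (1 - x n)))) \<longlonglongrightarrow> exp (- (real k * L))" by simp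
    have "(\<lambda>n. exp (- (real n * y n - real (Suc k) * y n))) \<longlonglongrightarrow> exp (- (real k * L - real (Suc k) * 0))"
      by (intro tendsto_intros ny y)
    then show "(\<lambda>n. exp (- (real n * y n - real (Suc k) * y n))) \<longlonglongrightarrow> exp (- (real k * L))" by simp
  qed
  then have "(\<lambda>n. c n - 2 * real (Suc k) * u n) \<longlonglongrightarrow> exp (- (real k * L)) - 2 * real (Suc k) * 0"
    by (intro tendsto_intros u)
  then have c': "(\<lambda>n. c n - 2 * real (Suc k) * u n) \<longlonglongrightarrow> exp (- (real k * L))"
    by simp
  show ?thesis
  proof (rule tendsto_sandwich[OF _ _ c' c])
    show "eventually (\<lambda>n. bernoulli_word.Pr (v n) dflt n (runs_longer_than k n) \<le> c n) sequentially"
      unfolding c_def using bernoulli_word.Pr_runs_longer_le[OF word] by simp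
    show "eventually (\<lambda>n. c n - 2 * real (Suc k) * u n
        \<le> bernoulli_word.Pr (v n) dflt n (runs_longer_than k n)) sequentially"
      using eventually_ge_at_top[of "Suc k"]
    proof eventually_elim
      case (elim n)
      then show ?case
        using bernoulli_word.Pr_runs_longer_ge[OF word, of k n n dflt] by (simp add: c_def u_def)
    qed
  qed
qed

text \<open>
  Survival is small if \<open>n u\<^sup>2 v\<close> is large, and the bound by adjacent true letters is small if
  \<open>n v\<^sup>2\<close> is small. For \<open>v \<ge> 1/2\<close> the first applies by hypothesis. For \<open>v < 1/2\<close> we have \<open>u > 1/2\<close>, and
  the threshold \<open>n powr (- 2/3)\<close> for \<open>v\<close>, which lies between \<open>1 / n\<close> and \<open>n powr (- 1/2)\<close>,
  decides which of the two is used.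
\<close>

lemma Pr_runs_longer_tendsto_0:
  fixes v :: "nat \<Rightarrow> real"
  assumes k: "1 \<le> k" and v: "\<And>n. 0 \<le> v n \<and> v n \<le> 1"
    and lim: "filterlim (\<lambda>n. real n * (1 - v n)\<^sup>2) at_top sequentially"
  shows "(\<lambda>n. bernoulli_word.Pr (v n) dflt n (runs_longer_than k n)) \<longlonglongrightarrow> 0"
proof -
  let ?X = "\<lambda>n. bernoulli_word.Pr (v n) dflt n (runs_longer_than k n)"
  let ?s = "\<lambda>n. real n * (1 - v n)\<^sup>2"
  have word: "bernoulli_word (v n)" for n
    using v by unfold_locales auto
  have exp_bound: "?X n \<le> exp (- ((real n / 3 - 1) * t))" if "t \<le> (1 - v n)\<^sup>2 * v n" "3 \<le> n" for n t
  proof -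
    have le1: "(1 - v n)\<^sup>2 * v n \<le> 1"
      using v[of n] by (intro mult_le_one power_le_one) auto
    have "?X n \<le> (1 - (1 - v n)\<^sup>2 * v n) ^ (n div 3)"
      using bernoulli_word.Pr_runs_longer_le[OF word] bernoulli_word.survival_block_bound[OF word k] order_trans by blast
    also have "\<dots> \<le> exp (- (real (n div 3) * ((1 - v n)\<^sup>2 * v n)))"
      using le1 by (rule one_minus_power_le_exp)
    also have "\<dots> \<le> exp (- ((real n / 3 - 1) * t))"
    proof -
      have "(real n / 3 - 1) * t \<le> (real n / 3 - 1) * ((1 - v n)\<^sup>2 * v n)"
        using that by (intro mult_left_mono) auto
      also have "real n / 3 - 1 \<le> real (n div 3)"
        by linarith
      then have "(real n / 3 - 1) * ((1 - v n)\<^sup>2 * v n) \<le> real (n div 3) * ((1 - v n)\<^sup>2 * v n)"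
        using v[of n] by (intro mult_right_mono) auto
      finally show ?thesis by simp
    qed
    finally show ?thesis .
  qed
  \<comment> \<open>One error term for each of the three ranges of \<open>v n\<close>. The summand \<open>1/2\<close> in the first one
    makes up for replacing \<open>n div 3\<close> by \<open>n / 3 - 1\<close>.\<close>
  define e1 where "e1 n = exp (1 / 2 - ?s n / 6)" for n
  define e2 where "e2 n = real n powr (- 1 / 3)" for n
  define e3 where "e3 n = exp (- ((real n / 3 - 1) * (real n powr (- 2 / 3) / 4)))" for n
  have upper: "eventually (\<lambda>n. ?X n \<le> e1 n + e2 n + e3 n) sequentially"
    using eventually_ge_at_top[of 3]
  proof eventually_elim
    case (elim n)
    have pos: "0 \<le> e1 n" "0 \<le> e2 n" "0 \<le> e3 n" by (simp_all add: e1_def e2_def e3_def)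
    consider "1 / 2 \<le> v n" | "v n < 1 / 2" "v n \<le> real n powr (- 2 / 3)"
      | "v n < 1 / 2" "real n powr (- 2 / 3) \<le> v n"
      by linarith
    then show ?case
    proof cases
      case 1
      have "(1 - v n)\<^sup>2 * (1 / 2) \<le> (1 - v n)\<^sup>2 * v n"
        using 1 by (intro mult_left_mono) auto
      from exp_bound[OF this elim] have "?X n \<le> exp (- ((real n / 3 - 1) * ((1 - v n)\<^sup>2 * (1 / 2))))" .
      also have "- ((real n / 3 - 1) * ((1 - v n)\<^sup>2 * (1 / 2))) = (1 - v n)\<^sup>2 / 2 - ?s n / 6"
        by (simp add: field_simps)
      also have "exp \<dots> \<le> e1 n"
        using v[of n] power_le_one[of "1 - v n" 2] by (simp add: e1_def)
      finally show ?thesis using pos by linarith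
    next
      case 2
      have "?X n \<le> real n * (v n)\<^sup>2"
        by (rule bernoulli_word.Pr_runs_longer_le_adjacent[OF word k])
      also have "\<dots> \<le> real n * (real n powr (- 2 / 3))\<^sup>2"
        using 2 v[of n] by (intro mult_left_mono power_mono) auto
      also have "\<dots> = real n powr 1 * (real n powr (- 2 / 3) * real n powr (- 2 / 3))"
        using elim by (simp add: power2_eq_square)
      also have "\<dots> = e2 n"
        unfolding powr_add[symmetric] by (simp add: e2_def)
      finally show ?thesis using pos by linarith
    next
      case 3
      have "(1 / 2)\<^sup>2 * real n powr (- 2 / 3) \<le> (1 - v n)\<^sup>2 * v n"
        using 3 by (intro mult_mono power_mono) auto
      then have "real n powr (- 2 / 3) / 4 \<le> (1 - v n)\<^sup>2 * v n"
        by (simp add: power2_eq_square)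
      from exp_bound[OF this elim] show ?thesis
        using pos by (simp add: e3_def)
    qed
  qed
  have e: "(\<lambda>n. e1 n + e2 n + e3 n) \<longlonglongrightarrow> 0 + 0 + 0"
  proof (intro tendsto_add)
    have "filterlim (\<lambda>n. - (1 / 2) + (1 / 6) * ?s n) at_top sequentially"
      by (intro filterlim_tendsto_add_at_top[OF tendsto_const]
          filterlim_tendsto_pos_mult_at_top[OF tendsto_const _ lim]) simp
    then have "filterlim (\<lambda>n. 1 / 2 - ?s n / 6) at_bot sequentially"
      by (simp add: filterlim_uminus_at_bot algebra_simps)
    then show "e1 \<longlonglongrightarrow> 0"
      unfolding e1_def by (rule filterlim_compose[OF exp_at_bot])
    show "e2 \<longlonglongrightarrow> 0" unfolding e2_def by real_asymp
    show "e3 \<longlonglongrightarrow> 0" unfolding e3_def by real_asymp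
  qed
  have e': "(\<lambda>n. e1 n + e2 n + e3 n) \<longlonglongrightarrow> 0" using e by simp
  show ?thesis
  proof (rule tendsto_sandwich[OF _ upper tendsto_const e'])
    show "eventually (\<lambda>n. 0 \<le> ?X n) sequentially"
      by (intro always_eventually allI bernoulli_word.Pr_nonneg word)
  qed
qed

section \<open>Back to compositions\<close>

lemma powr_minus_half_square: "(real n powr - (1 / 2))\<^sup>2 = 1 / real n"
proof (cases "n = 0")
  case False
  then have "(real n powr - (1 / 2))\<^sup>2 = real n powr (- 1)"
    unfolding power2_eq_square powr_add[symmetric] by simp
  then show ?thesis using False by (simp add: powr_minus_divide)
qed simp

lemma n_mult_square_at_top:
  fixes w :: "nat \<Rightarrow> real"
  assumes "(\<lambda>n. real n powr (- 1 / 2)) \<in> o(w)"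
  shows "filterlim (\<lambda>n. real n * (w n)\<^sup>2) at_top sequentially"
  unfolding filterlim_at_top_gt[where c = 0]
proof (intro allI impI)
  fix Z :: real assume Z: "0 < Z"
  have "eventually (\<lambda>n. norm (real n powr (- 1 / 2)) \<le> 1 / sqrt Z * norm (w n)) sequentially"
    using assms Z by (intro landau_o.smallD) auto
  then show "eventually (\<lambda>n. Z \<le> real n * (w n)\<^sup>2) sequentially"
    using eventually_gt_at_top[of 0]
  proof eventually_elim
    case (elim n)
    have "(real n powr (- 1 / 2))\<^sup>2 \<le> (1 / sqrt Z * \<bar>w n\<bar>)\<^sup>2"
      using elim by (intro power_mono) auto
    then have "1 / real n \<le> (w n)\<^sup>2 / Z"
      using elim Z by (simp add: power_mult_distrib power_divide powr_minus_half_square)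
    then show ?case using elim Z by (simp add: field_simps)
  qed
qed

lemma n_mult_square_tendsto:
  fixes w :: "nat \<Rightarrow> real"
  assumes "(\<lambda>n. w n / real n powr (- 1 / 2)) \<longlonglongrightarrow> a"
  shows "(\<lambda>n. real n * (w n)\<^sup>2) \<longlonglongrightarrow> a\<^sup>2"
proof (rule Lim_transform_eventually)
  show "(\<lambda>n. (w n / real n powr (- 1 / 2))\<^sup>2) \<longlonglongrightarrow> a\<^sup>2"
    using assms by (intro tendsto_intros)
  show "eventually (\<lambda>n. (w n / real n powr (- 1 / 2))\<^sup>2 = real n * (w n)\<^sup>2) sequentially"
    using eventually_gt_at_top[of 0]
    by eventually_elim (simp add: power_divide powr_minus_half_square)
qed

lemma bool_pmf_eq_bernoulli:
  "M = bernoulli_pmf (pmf M True)"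
proof (rule pmf_eqI)
  show "pmf M b = pmf (bernoulli_pmf (pmf M True)) b" for b
    by (cases b) (simp_all add: pmf_le_1 pmf_False_conv_True)
qed

lemma map_geometric_pmf:
  assumes "0 < q" "q \<le> 1"
  shows "map_pmf (\<lambda>j. j \<noteq> 0) (geometric_pmf q) = bernoulli_pmf (1 - q)"
    and "map_pmf (\<lambda>j. j = 0) (geometric_pmf q) = bernoulli_pmf q"
proof -
  have "pmf (map_pmf (\<lambda>j. j \<noteq> 0) (geometric_pmf q)) False = q"
    using assms by (simp add: pmf_map vimage_def measure_pmf_single)
  then show "map_pmf (\<lambda>j. j \<noteq> 0) (geometric_pmf q) = bernoulli_pmf (1 - q)"
    by (subst bool_pmf_eq_bernoulli) (simp add: pmf_True_conv_False)
  have "pmf (map_pmf (\<lambda>j. j = 0) (geometric_pmf q)) True = q"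
    using assms by (simp add: pmf_map vimage_def measure_pmf_single)
  then show "map_pmf (\<lambda>j. j = 0) (geometric_pmf q) = bernoulli_pmf q"
    by (subst bool_pmf_eq_bernoulli) simp
qed

lemma prob_comp_min:
  assumes "0 \<le> p" "p < 1"
  shows "measure_pmf.prob (geom_composition n p) {C. k < comp_min n C} =
    bernoulli_word.Pr p False n (runs_longer_than k n)"
proof -
  interpret bernoulli_word p False k using assms by unfold_locales auto
  have "Pi_pmf {1..n} False (\<lambda>_. bernoulli_pmf p) =
      map_pmf (\<lambda>C. (\<lambda>j. j \<noteq> 0) \<circ> C) (geom_composition n p)"
    unfolding geom_composition_def
    using Pi_pmf_map[of "{1..n}" "\<lambda>j. j \<noteq> 0" 0 False "\<lambda>_. geometric_pmf (1 - p)"] assms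
    by (simp only: map_geometric_pmf) simp
  moreover have "k < comp_min n C \<longleftrightarrow> runs_longer_than k n (\<lambda>i. C i \<noteq> 0)" for C
    unfolding comp_min_def components_def by (rule Min_run_gt_iff)
  ultimately show ?thesis
    by (simp add: Pr_def vimage_def o_def)
qed

lemma prob_gap_min:
  assumes "0 \<le> p" "p < 1"
  shows "measure_pmf.prob (geom_composition n p) {C. k < gap_min n C} =
    bernoulli_word.Pr (1 - p) True n (runs_longer_than k n)"
proof -
  interpret bernoulli_word "1 - p" True k using assms by unfold_locales auto
  have "Pi_pmf {1..n} True (\<lambda>_. bernoulli_pmf (1 - p)) =
      map_pmf (\<lambda>C. (\<lambda>j. j = 0) \<circ> C) (geom_composition n p)"
    unfolding geom_composition_def
    using Pi_pmf_map[of "{1..n}" "\<lambda>j. j = 0" 0 True "\<lambda>_. geometric_pmf (1 - p)"] assms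
    by (simp only: map_geometric_pmf) simp
  moreover have "k < gap_min n C \<longleftrightarrow> runs_longer_than k n (\<lambda>i. C i = 0)" for C
    unfolding gap_min_def gaps_def by (rule Min_run_gt_iff)
  ultimately show ?thesis
    by (simp add: Pr_def vimage_def o_def)
qed

text \<open>
  The three regimes of the theorem compare \<open>w\<close>, the probability of a false letter, with
  \<open>n powr (- 1/2)\<close>; squaring turns them into \<open>n w\<^sup>2\<close> tending to infinity, to \<open>\<alpha>\<^sup>2\<close>, and to \<open>0\<close>.
\<close>

lemma runs_longer_limits:
  fixes w X :: "nat \<Rightarrow> real" and k :: nat
  defines "r \<equiv> \<lambda>n. real n powr (- 1 / 2)"
  assumes k: "1 \<le> k" and \<alpha>: "0 < \<alpha>" and w: "\<And>n. 0 \<le> w n \<and> w n \<le> 1"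
    and X: "\<And>n. X n = bernoulli_word.Pr (1 - w n) dflt n (runs_longer_than k n)"
  shows "r \<in> o(w) \<Longrightarrow> X \<longlonglongrightarrow> 0"
    and "w \<sim>[at_top] (\<lambda>n. \<alpha> * r n) \<Longrightarrow> X \<sim>[at_top] (\<lambda>n. exp (- (\<alpha>\<^sup>2 * real k)))"
    and "w \<in> o(r) \<Longrightarrow> X \<sim>[at_top] (\<lambda>n. 1)"
proof -
  have w': "0 \<le> 1 - w n \<and> 1 - w n \<le> 1" for n using w[of n] by simp
  have r: "eventually (\<lambda>n. r n \<noteq> 0) sequentially"
    unfolding r_def using eventually_gt_at_top[of 0] by eventually_elim simp
  have lim: "X \<sim>[at_top] (\<lambda>n. exp (- (real k * a\<^sup>2)))" if "(\<lambda>n. w n / r n) \<longlonglongrightarrow> a" for a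
    unfolding X[abs_def]
    by (intro tendsto_imp_asymp_equiv_const Pr_runs_longer_tendsto_exp w')
       (use n_mult_square_tendsto[OF that[unfolded r_def]] in simp_all)
  show "X \<longlonglongrightarrow> 0" if "r \<in> o(w)"
    unfolding X[abs_def]
    by (rule Pr_runs_longer_tendsto_0[OF k w'])
       (use n_mult_square_at_top[of w] that in \<open>simp add: r_def\<close>)
  show "X \<sim>[at_top] (\<lambda>n. exp (- (\<alpha>\<^sup>2 * real k)))" if "w \<sim>[at_top] (\<lambda>n. \<alpha> * r n)"
  proof -
    have "(\<lambda>n. w n / (\<alpha> * r n)) \<longlonglongrightarrow> 1"
      using that by (rule asymp_equivD_strong) (use r \<alpha> in \<open>auto elim: eventually_mono\<close>)
    then have "(\<lambda>n. \<alpha> * (w n / (\<alpha> * r n))) \<longlonglongrightarrow> \<alpha> * 1"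
      by (intro tendsto_intros)
    then have "(\<lambda>n. w n / r n) \<longlonglongrightarrow> \<alpha>"
      using \<alpha> by simp
    from lim[OF this] show ?thesis by (simp add: mult.commute)
  qed
  show "X \<sim>[at_top] (\<lambda>n. 1)" if "w \<in> o(r)"
    using lim[OF smalloD_tendsto[OF that]] by simp
qed

theorem proposition3p7:
  fixes k :: nat and \<alpha> :: real and p q :: "nat \<Rightarrow> real"
  assumes k: "k \<ge> 1"
    and \<alpha>: "\<alpha> > 0"
    and p: "\<And>n. 0 \<le> p n \<and> p n < 1"
    and q: "\<And>n. q n = 1 - p n"
  defines "Pcomp \<equiv> \<lambda>n. measure_pmf.prob (geom_composition n (p n)) {C. comp_min n C > k}"
    and "Pgap \<equiv> \<lambda>n. measure_pmf.prob (geom_composition n (p n)) {C. gap_min n C > k}"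
    and "r \<equiv> \<lambda>n. real n powr (- 1 / 2)"
  shows "(r \<in> o(q) \<longrightarrow> Pcomp \<longlonglongrightarrow> 0) \<and>
         (q \<sim>[at_top] (\<lambda>n. \<alpha> * r n) \<longrightarrow> Pcomp \<sim>[at_top] (\<lambda>n. exp (- (\<alpha>\<^sup>2 * real k)))) \<and>
         (q \<in> o(r) \<longrightarrow> Pcomp \<sim>[at_top] (\<lambda>n. 1)) \<and>
         (p \<in> o(r) \<longrightarrow> Pgap \<sim>[at_top] (\<lambda>n. 1)) \<and>
         (p \<sim>[at_top] (\<lambda>n. \<alpha> * r n) \<longrightarrow> Pgap \<sim>[at_top] (\<lambda>n. exp (- (\<alpha>\<^sup>2 * real k)))) \<and>
         (r \<in> o(p) \<longrightarrow> Pgap \<longlonglongrightarrow> 0)"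
proof -
  have q01: "0 \<le> q n \<and> q n \<le> 1" and p01: "0 \<le> p n \<and> p n \<le> 1" for n
    using p[of n] q[of n] by auto
  have "Pcomp n = bernoulli_word.Pr (1 - q n) False n (runs_longer_than k n)" for n
    using p[of n] by (simp add: Pcomp_def prob_comp_min q)
  note comp = runs_longer_limits[where X = Pcomp, OF k \<alpha> q01 this]
  have "Pgap n = bernoulli_word.Pr (1 - p n) True n (runs_longer_than k n)" for n
    using p[of n] by (simp add: Pgap_def prob_gap_min)
  note gap = runs_longer_limits[where X = Pgap, OF k \<alpha> p01 this]
  show ?thesis unfolding r_def using comp gap by blast
qed

end
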